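(* Let $n\ge 1$ be an integer and $V=\mathbb{C}^n$ with its standard scalar product $\langle\cdot,\cdot\rangle$. Then for any $\varepsilon>0$ there are a norm $f:V\to\mathbb{R}^+$ and a nonzero vector $v\in\mathbb{R}^n$ such that: (1) $f$ admits a unique, up to equivalence, $f$-minimal basis $(e_1,\dots,e_n)$, with $e_1,\dots,e_n\in\mathbb{R}^n$; and (2) $$(2^n-1-\varepsilon)\,f(v)\ \le\ \sum_{i=1}^n |\langle v,e_i\rangle|\, f(e_i).$$
   Context: $\mathbb{R}^+$ denotes the non-negative reals, and $\mathbb{R}^n\subset\mathbb{C}^n$ is the set of vectors with real coordinates. For a finite-dimensional scalar product space $V$ over $\mathbb{F}\in\{\mathbb{R},\mathbb{C}\}$, $\mathbb{S}_1=\{u\in V:\langle u,u\rangle=1\}$. For a norm $f$ on an $n$-dimensional scalar product space $V$, an $f$-minimal basis is an (ordered, orthonormal) basis of $V$ defined inductively on $n$. If $n=1$, then $(b)$ is $f$-minimal for any $b\in\mathbb{S}_1$. If $n>1$, choose $b_1\in\arg\min\{f(b): b\in\mathbb{S}_1\}$, let $V_1=\{u\in V:\langle u,b_1\rangle=0\}$ and let $f_1=f\upharpoonright V_1$; if $(b_2,\dots,b_n)$ is an $f_1$-minimal basis of $V_1$, then $(b_1,b_2,\dots,b_n)$ is an $f$-minimal basis of $V$. Two orthonormal bases $(b_1,\dots,b_n)$ and $(e_1,\dots,e_n)$ of $V$ are equivalent if for every $i\le n$ there is $\alpha_i\in\mathbb{F}$ with $|\alpha_i|=1$ and $e_i=\alpha_i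 b_i$. Thus (1) means that $(e_1,\dots,e_n)$ is an $f$-minimal basis consisting of real vectors and every $f$-minimal basis of $V$ is equivalent to it. *)

theory Defs
  imports "HOL-Analysis.Analysis"
begin

text \<open>The space \<open>\<complex>\<^sup>n\<close> is \<^typ>\<open>complex ^ 'n\<close> with complex scalar multiplication \<open>*s\<close>; its complex
  subspaces and complex dimension are \<^const>\<open>vec.subspace\<close> and \<^const>\<open>vec.dim\<close>
  (the constants \<^const>\<open>subspace\<close>, \<^const>\<open>dim\<close> and \<^const>\<open>inner\<close> refer to the underlying real space).\<close>

definition cscalar :: "complex ^ 'n \<Rightarrow> complex ^ 'n \<Rightarrow> complex"
  where "cscalar u v = (\<Sum>i\<in>UNIV. u $ i * cnj (v $ i))"

definition cunit_sphere :: "(complex ^ 'n) set"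
  where "cunit_sphere = {u. cscalar u u = 1}"

definition real_vectors :: "(complex ^ 'n) set"
  where "real_vectors = {u. \<forall>i. u $ i \<in> \<real>}"

definition is_cnorm :: "(complex ^ 'n \<Rightarrow> real) \<Rightarrow> bool"
  where "is_cnorm f \<longleftrightarrow>
    (\<forall>u. 0 \<le> f u) \<and>
    (\<forall>u. f u = 0 \<longleftrightarrow> u = 0) \<and>
    (\<forall>c u. f (c *s u) = cmod c * f u) \<and>
    (\<forall>u w. f (u + w) \<le> f u + f w)"

text \<open>The recursion passes to orthogonal complements, so the notion is defined for the restriction
  of \<open>f\<close> to a subspace \<open>W\<close>; a minimal basis of the whole space is the case \<open>W = UNIV\<close>.\<close>

inductive minimal_basis ::
  "(complex ^ 'n \<Rightarrow> real) \<Rightarrow> (complex ^ 'n) set \<Rightarrow> (complex ^ 'n) list \<Rightarrow> bool"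
  for f where
  single: "minimal_basis f W [b]"
    if "vec.subspace W" and "vec.dim W = 1" and "b \<in> W \<inter> cunit_sphere"
| step: "minimal_basis f W (b # bs)"
    if "vec.subspace W" and "vec.dim W > 1"
      and "is_arg_min f (\<lambda>u. u \<in> W \<inter> cunit_sphere) b"
      and "minimal_basis f {u \<in> W. cscalar u b = 0} bs"

definition equivalent_bases :: "(complex ^ 'n) list \<Rightarrow> (complex ^ 'n) list \<Rightarrow> bool"
  where "equivalent_bases bs es \<longleftrightarrow>
    length bs = length es \<and>
    (\<forall>i < length bs. \<exists>\<alpha>. cmod \<alpha> = 1 \<and> es ! i = \<alpha> *s bs ! i)"

text \<open>Minimal bases are orthonormal bases of \<open>W\<close>.\<close>

lemma cscalar_diff_left: "cscalar (u - v) w = cscalar u w - cscalar v w"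
  by (simp add: cscalar_def algebra_simps sum_subtractf)

lemma cscalar_scale_left: "cscalar (c *s u) w = c * cscalar u w"
  by (simp add: cscalar_def algebra_simps sum_distrib_left)

lemma cscalar_add_left: "cscalar (u + v) w = cscalar u w + cscalar v w"
  by (simp add: cscalar_def algebra_simps sum.distrib)

lemma cscalar_zero_left [simp]: "cscalar 0 w = 0"
  by (simp add: cscalar_def)

lemma cscalar_commute: "cscalar u v = cnj (cscalar v u)"
  by (simp add: cscalar_def mult.commute)

lemma subspace_complement:
  assumes "vec.subspace W"
  shows "vec.subspace {u \<in> W. cscalar u b = 0}"
  using assms by (auto simp: vec.subspace_def cscalar_add_left cscalar_scale_left)

lemma dim_complement:
  assumes W: "vec.subspace W" and b: "b \<in> W" "cscalar b b = 1"
  shows "vec.dim W = Suc (vec.dim {u \<in> W. cscalar u b = 0})"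
proof -
  let ?C = "{u \<in> W. cscalar u b = 0}"
  have C: "vec.span ?C = ?C"
    using subspace_complement[OF W] by (simp add: vec.span_eq_iff)
  have "W \<subseteq> vec.span (insert b ?C)"
  proof
    fix u assume u: "u \<in> W"
    let ?k = "cscalar u b"
    have "u - ?k *s b \<in> ?C"
      using u b W by (simp add: cscalar_diff_left cscalar_scale_left vec.subspace_diff vec.subspace_scale)
    then show "u \<in> vec.span (insert b ?C)"
      unfolding vec.span_insert C by blast
  qed
  moreover have "vec.span (insert b ?C) \<subseteq> W"
    by (rule vec.span_minimal) (use b W in auto)
  ultimately have "vec.dim W = vec.dim (insert b ?C)"
    by (metis subset_antisym vec.dim_span)
  then show ?thesis
    using b by (simp add: vec.dim_insert C)
qed

lemma minimal_basis_length: "minimal_basis f W bs \<Longrightarrow> length bs = vec.dim W"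
proof (induction rule: minimal_basis.induct)
  case (step W b bs)
  then have "vec.dim W = Suc (vec.dim {u \<in> W. cscalar u b = 0})"
    by (intro dim_complement) (auto simp: is_arg_min_def cunit_sphere_def)
  with step.IH show ?case by simp
qed simp

lemma minimal_basis_orthonormal:
  "minimal_basis f W bs \<Longrightarrow> set bs \<subseteq> W \<and>
    (\<forall>i < length bs. \<forall>j < length bs. cscalar (bs ! i) (bs ! j) = (if i = j then 1 else 0))"
proof (induction rule: minimal_basis.induct)
  case (single W b)
  then show ?case by (auto simp: cunit_sphere_def)
next
  case (step W b bs)
  have b: "b \<in> W" "cscalar b b = 1"
    using step by (auto simp: is_arg_min_def cunit_sphere_def)
  have orth: "cscalar (bs ! i) b = 0" "cscalar b (bs ! i) = 0" if "i < length bs" for i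
  proof -
    show "cscalar (bs ! i) b = 0" using step.IH that nth_mem by blast
    then show "cscalar b (bs ! i) = 0" by (subst cscalar_commute) simp
  qed
  show ?case
    using step.IH b orth by (auto simp: nth_Cons split: nat.splits)
qed

end

theory Submission
  imports Defs
begin

text \<open>
  Let \<open>f\<close> be the largest norm with \<open>f e\<^sub>j \<le> w\<^sub>j\<close> and \<open>f v \<le> s\<close>, where \<open>v = (a\<^sub>0, \<dots>, a\<^sub>n\<^sub>-\<^sub>1)\<close> with
  \<open>a\<^sub>j = \<delta>\<^sup>j\<close>, \<open>w\<^sub>j = (2/\<delta>)\<^sup>j\<close> and \<open>s = 1 + \<eta>\<close>. On the span of \<open>e\<^sub>k, \<dots>, e\<^sub>n\<^sub>-\<^sub>1\<close> the use of a multiple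
  \<open>t v\<close> costs \<open>(s + \<Sum>\<^sub>j\<^sub><\<^sub>k w\<^sub>j a\<^sub>j) |t| = (2\<^sup>k + \<eta>) |t|\<close>, which for small \<open>\<delta>\<close> is no cheaper than \<open>w\<^sub>k\<close>
  times the \<open>\<ell>\<^sup>1\<close> norm of the tail of \<open>t v\<close>. Hence there \<open>f\<close> dominates \<open>w\<^sub>k\<close> times the \<open>\<ell>\<^sup>1\<close> norm,
  and so \<open>w\<^sub>k\<close> times the Euclidean norm, with equality on the unit sphere only at multiples of \<open>e\<^sub>k\<close>.
  So \<open>(e\<^sub>0, \<dots>, e\<^sub>n\<^sub>-\<^sub>1)\<close> is the minimal basis, \<open>f e\<^sub>j = w\<^sub>j\<close>, and \<open>\<Sum> w\<^sub>j a\<^sub>j = 2\<^sup>n - 1\<close> while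
  \<open>f v \<le> 1 + \<eta>\<close>.
\<close>

section \<open>The unit sphere and the l1 norm on it\<close>

lemma cscalar_axis_right: "cscalar u (axis i 1) = u $ i"
proof -
  have "cscalar u (axis i 1) = (\<Sum>j\<in>UNIV. if j = i then u $ j else 0)"
    unfolding cscalar_def axis_def by (intro sum.cong) auto
  then show ?thesis by simp
qed

lemma cscalar_self: "cscalar u u = complex_of_real (\<Sum>i\<in>UNIV. (cmod (u $ i))\<^sup>2)"
  unfolding cscalar_def of_real_sum complex_norm_square ..

lemma cunit_sphere_iff: "u \<in> cunit_sphere \<longleftrightarrow> (\<Sum>i\<in>UNIV. (cmod (u $ i))\<^sup>2) = 1"
  unfolding cunit_sphere_def mem_Collect_eq cscalar_self of_real_eq_1_iff ..

lemma cscalar_scale_right: "cscalar u (c *s v) = cnj c * cscalar u v"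
  by (metis cscalar_commute cscalar_scale_left complex_cnj_mult)

lemma axis_in_cunit_sphere: "axis i 1 \<in> cunit_sphere"
  by (simp add: cunit_sphere_def cscalar_axis_right)

lemma cunit_sphere_component_le: "u \<in> cunit_sphere \<Longrightarrow> cmod (u $ i) \<le> 1"
  using member_le_sum[of i UNIV "\<lambda>i. (cmod (u $ i))\<^sup>2"]
  by (simp add: cunit_sphere_iff power_le_one_iff abs_le_square_iff[of _ 1, simplified])

lemma cunit_sphere_l1_ge:
  assumes "u \<in> cunit_sphere"
  shows "1 \<le> (\<Sum>i\<in>UNIV. cmod (u $ i))"
proof -
  have "(\<Sum>i\<in>UNIV. (cmod (u $ i))\<^sup>2) \<le> (\<Sum>i\<in>UNIV. cmod (u $ i))"
    by (intro sum_mono) (simp add: power2_eq_square mult_left_le cunit_sphere_component_le[OF assms])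
  with assms show ?thesis by (simp add: cunit_sphere_iff)
qed

text \<open>If the l1 norm equals the sum of squares, every modulus x satisfies x (1 - x) = 0, so it
  is 0 or 1; total 1 leaves a single nonzero coordinate.\<close>

lemma cunit_sphere_l1_eq:
  assumes u: "u \<in> cunit_sphere" and l1: "(\<Sum>i\<in>UNIV. cmod (u $ i)) = 1"
  obtains i where "u = u $ i *s axis i 1" "cmod (u $ i) = 1"
proof -
  have "(\<Sum>i\<in>UNIV. cmod (u $ i) * (1 - cmod (u $ i))) = 0"
    using u l1 by (simp add: cunit_sphere_iff algebra_simps power2_eq_square sum_subtractf)
  then have *: "cmod (u $ i) * (1 - cmod (u $ i)) = 0" for i
    by (subst (asm) sum_nonneg_eq_0_iff) (auto simp: cunit_sphere_component_le[OF u])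
  obtain i where "u $ i \<noteq> 0"
    using l1 by (metis norm_zero sum.neutral zero_neq_one)
  with * have i: "cmod (u $ i) = 1" by force
  have "(\<Sum>j\<in>UNIV - {i}. cmod (u $ j)) = 0"
    using l1 i by (simp add: sum.remove[of UNIV i])
  then have "u $ j = 0" if "j \<noteq> i" for j
    using that by (subst (asm) sum_nonneg_eq_0_iff) auto
  then have "u = u $ i *s axis i 1"
    by (auto simp: vec_eq_iff axis_def)
  with i show thesis by (rule that[rotated])
qed

section \<open>The norm, the basis and the flag of subspaces\<close>

locale flag_norm =
  fixes h :: "nat \<Rightarrow> 'n::finite" and w a :: "nat \<Rightarrow> real" and s :: real
  assumes h: "bij_betw h {..<CARD('n)} UNIV"
    and w: "strict_mono w" and w_pos: "\<And>j. 0 < w j"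
    and a_pos: "\<And>j. 0 < a j"
    and tail: "\<And>k. k < CARD('n) \<Longrightarrow> w k * (\<Sum>j=k..<CARD('n). a j) \<le> s + (\<Sum>j<k. w j * a j)"
begin

text \<open>The price of writing \<open>u\<close> as \<open>t\<close> times \<open>v\<close> plus a
  combination of the \<open>e j\<close>, at prices \<open>s\<close> and \<open>w j\<close>; once
  \<open>t\<close> is fixed, the remaining coefficients are determined.\<close>

definition cost :: "complex ^ 'n \<Rightarrow> complex \<Rightarrow> real"
  where "cost u t = (\<Sum>j<CARD('n). w j * cmod (u $ h j - t * of_real (a j))) + s * cmod t"

definition f :: "complex ^ 'n \<Rightarrow> real"
  where "f u = (INF t. cost u t)"

definition e :: "nat \<Rightarrow> complex ^ 'n"
  where "e j = axis (h j) 1"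

definition v :: "complex ^ 'n"
  where "v = (\<chi> i. of_real (a (the_inv_into {..<CARD('n)} h i)))"

text \<open>These are the successive orthogonal complements in the recursion. As \<open>'n\<close>
  is an arbitrary finite type, \<open>h\<close> supplies the order of the coordinates.\<close>

definition flag :: "nat \<Rightarrow> (complex ^ 'n) set"
  where "flag k = {u. \<forall>j<k. u $ h j = 0}"

lemma sum_h: "(\<Sum>i\<in>UNIV. g i) = (\<Sum>j<CARD('n). g (h j))"
  using sum.reindex_bij_betw[OF h, of g] by simp

lemma ex_h: obtains j where "j < CARD('n)" "i = h j"
  using h by (metis UNIV_I bij_betw_iff_bijections lessThan_iff)

lemma h_eq_iff: "i < CARD('n) \<Longrightarrow> j < CARD('n) \<Longrightarrow> h i = h j \<longleftrightarrow> i = j"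
  using h by (auto simp: bij_betw_def inj_on_def)

lemma v_h: "j < CARD('n) \<Longrightarrow> v $ h j = of_real (a j)"
  using h by (simp add: v_def the_inv_into_f_f bij_betw_def)

lemma s_nonneg: "0 \<le> s"
proof -
  have "0 \<le> w 0 * (\<Sum>j=0..<CARD('n). a j)"
    using w_pos a_pos by (intro mult_nonneg_nonneg sum_nonneg) (auto intro: less_imp_le)
  with tail[of 0] show ?thesis by simp
qed

section \<open>Properties of the cost\<close>

lemma cost_nonneg: "0 \<le> cost u t"
  unfolding cost_def using w_pos s_nonneg
  by (intro add_nonneg_nonneg sum_nonneg mult_nonneg_nonneg) (auto intro: less_imp_le)

lemma f_le_cost: "f u \<le> cost u t"
  unfolding f_def by (rule cINF_lower) (auto intro: bdd_belowI2 cost_nonneg)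

lemma f_greatest: "(\<And>t. c \<le> cost u t) \<Longrightarrow> c \<le> f u"
  unfolding f_def by (rule cINF_greatest) auto

lemma cost_scale: "cost (c *s u) (c * t) = cmod c * cost u t"
proof -
  have "cmod (c * x - c * t * y) = cmod c * cmod (x - t * y)" for x y
    by (simp add: right_diff_distrib mult.assoc flip: norm_mult)
  then show ?thesis
    by (simp add: cost_def distrib_left sum_distrib_left norm_mult mult.left_commute)
qed

text \<open>Subadditivity jointly in the vector and the scalar survives the infimum and gives the
  triangle inequality for \<open>f\<close>.\<close>

lemma cost_add: "cost (u + u') (t + t') \<le> cost u t + cost u' t'"
proof -
  have "w j * cmod ((u + u') $ h j - (t + t') * of_real (a j))
      \<le> w j * cmod (u $ h j - t * of_real (a j)) + w j * cmod (u' $ h j - t' * of_real (a j))" for j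
  proof -
    have "(u + u') $ h j - (t + t') * of_real (a j) =
        (u $ h j - t * of_real (a j)) + (u' $ h j - t' * of_real (a j))"
      by (simp add: algebra_simps)
    then show ?thesis
      unfolding distrib_left[symmetric]
      using norm_triangle_ineq w_pos[of j] by (metis mult_le_cancel_left_pos)
  qed
  then have "(\<Sum>j<CARD('n). w j * cmod ((u + u') $ h j - (t + t') * of_real (a j)))
      \<le> (\<Sum>j<CARD('n). w j * cmod (u $ h j - t * of_real (a j))) +
        (\<Sum>j<CARD('n). w j * cmod (u' $ h j - t' * of_real (a j)))"
    unfolding sum.distrib[symmetric] by (intro sum_mono)
  moreover have "s * cmod (t + t') \<le> s * cmod t + s * cmod t'"
    unfolding distrib_left[symmetric] by (intro mult_left_mono norm_triangle_ineq s_nonneg)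
  ultimately show ?thesis unfolding cost_def by linarith
qed

lemma cost_ge_l1:
  assumes k: "k < CARD('n)" and u: "u \<in> flag k"
  shows "w k * (\<Sum>i\<in>UNIV. cmod (u $ i)) \<le> cost u t"
proof -
  \<comment> \<open>Coefficient of |t| in a coordinatewise estimate: below \<open>k\<close>, where
    \<open>u\<close> vanishes, the cost is exactly \<open>w j * a j\<close> times |t|; from
    \<open>k\<close> on, the triangle inequality loses \<open>w k * a j\<close> times |t|. Summed
    up, \<open>tail\<close> bounds these by \<open>s\<close>.\<close>
  let ?d = "\<lambda>j. if j < k then - (w j * a j) else w k * a j"
  have "w k * cmod (u $ h j) \<le> w j * cmod (u $ h j - t * of_real (a j)) + ?d j * cmod t" for j
  proof (cases "j < k")
    case True
    then show ?thesis
      using u a_pos[of j] by (simp add: flag_def norm_mult)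
  next
    case False
    then have "w k \<le> w j"
      using w by (simp add: strict_mono_less_eq)
    have "cmod (u $ h j) \<le> cmod (u $ h j - t * of_real (a j)) + cmod (t * of_real (a j))"
      by (metis diff_add_cancel norm_triangle_ineq)
    then have "w k * cmod (u $ h j) \<le> w k * cmod (u $ h j - t * of_real (a j)) + w k * (a j * cmod t)"
      using w_pos[of k] a_pos[of j] by (simp add: norm_mult mult.commute flip: distrib_left)
    also have "\<dots> \<le> w j * cmod (u $ h j - t * of_real (a j)) + w k * (a j * cmod t)"
      using \<open>w k \<le> w j\<close> by (simp add: mult_right_mono)
    finally show ?thesis using False by simp
  qed
  then have "w k * (\<Sum>i\<in>UNIV. cmod (u $ i)) \<le>
      (\<Sum>j<CARD('n). w j * cmod (u $ h j - t * of_real (a j)) + ?d j * cmod t)"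
    unfolding sum_h sum_distrib_left by (intro sum_mono)
  also have "\<dots> = (\<Sum>j<CARD('n). w j * cmod (u $ h j - t * of_real (a j))) +
      (\<Sum>j<CARD('n). ?d j) * cmod t"
    by (simp add: sum.distrib sum_distrib_right)
  also have "(\<Sum>j<CARD('n). ?d j) = (\<Sum>j<k. ?d j) + (\<Sum>j=k..<CARD('n). ?d j)"
    using k by (simp only: lessThan_atLeast0 sum.atLeastLessThan_concat)
  also have "\<dots> = - (\<Sum>j<k. w j * a j) + w k * (\<Sum>j=k..<CARD('n). a j)"
    by (simp add: sum_negf sum_distrib_left)
  also have "\<dots> * cmod t \<le> s * cmod t"
    using tail[OF k] by (intro mult_right_mono) auto
  finally show ?thesis by (simp add: cost_def)
qed

lemma f_ge_l1: "k < CARD('n) \<Longrightarrow> u \<in> flag k \<Longrightarrow> w k * (\<Sum>i\<in>UNIV. cmod (u $ i)) \<le> f u"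
  by (intro f_greatest cost_ge_l1)

section \<open>The norm axioms\<close>

lemma f_scale_le: "f (c *s u) \<le> cmod c * f u"
proof (cases "c = 0")
  case True
  then show ?thesis using f_le_cost[of 0 0] by (simp add: cost_def)
next
  case False
  have "f (c *s u) / cmod c \<le> f u"
  proof (rule f_greatest)
    show "f (c *s u) / cmod c \<le> cost u t" for t
      using False f_le_cost[of "c *s u" "c * t"] by (simp add: cost_scale field_simps)
  qed
  with False show ?thesis by (simp add: field_simps)
qed

text \<open>For nonzero \<open>c\<close>, the reverse inequality is \<open>f_scale_le\<close> for
  \<open>inverse c\<close> and \<open>c *s u\<close>.\<close>

lemma f_scale: "f (c *s u) = cmod c * f u"
proof (cases "c = 0")
  case True
  have "0 \<le> f (c *s u)" by (intro f_greatest cost_nonneg)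
  with True f_scale_le[of c u] show ?thesis by simp
next
  case False
  have "f u \<le> cmod (inverse c) * f (c *s u)"
    using False f_scale_le[of "inverse c" "c *s u"] by (simp add: vector_smult_assoc)
  then have "cmod c * f u \<le> cmod c * (cmod (inverse c) * f (c *s u))"
    by (rule mult_left_mono) simp
  also have "\<dots> = f (c *s u)"
    using False by (simp add: norm_inverse flip: mult.assoc)
  finally have "cmod c * f u \<le> f (c *s u)" .
  with f_scale_le[of c u] show ?thesis by simp
qed

lemma is_cnorm_f: "is_cnorm f"
  unfolding is_cnorm_def
proof (intro conjI allI)
  show "0 \<le> f u" for u by (intro f_greatest cost_nonneg)
  show "f (c *s u) = cmod c * f u" for c u by (rule f_scale)
  show "f u = 0 \<longleftrightarrow> u = 0" for u
  proof
    assume "f u = 0"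
    then have "w 0 * (\<Sum>i\<in>UNIV. cmod (u $ i)) \<le> 0"
      using f_ge_l1[of 0 u] by (simp add: flag_def)
    then have "(\<Sum>i\<in>UNIV. cmod (u $ i)) \<le> 0"
      using w_pos[of 0] by (simp add: mult_le_0_iff)
    then have "(\<Sum>i\<in>UNIV. cmod (u $ i)) = 0"
      by (intro antisym sum_nonneg) auto
    then show "u = 0"
      by (subst (asm) sum_nonneg_eq_0_iff) (auto simp: vec_eq_iff)
  next
    assume "u = 0"
    with f_scale[of 0 0] show "f u = 0" by simp
  qed
  show "f (u + u') \<le> f u + f u'" for u u'
  proof -
    have "f (u + u') \<le> cost u t + cost u' t'" for t t'
      using f_le_cost[of "u + u'" "t + t'"] cost_add[of u u' t t'] by linarith
    \<comment> \<open>The scalars \<open>t\<close> and \<open>t'\<close> are independent, so the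
      infimum is taken over one at a time.\<close>
    then have "f (u + u') - cost u t \<le> f u'" for t
      by (intro f_greatest) (simp add: algebra_simps)
    then have "f (u + u') - f u' \<le> f u"
      by (intro f_greatest) (simp add: algebra_simps)
    then show ?thesis by simp
  qed
qed

section \<open>Minimizers on the members of the flag\<close>

lemma e_in_flag: "k < CARD('n) \<Longrightarrow> e k \<in> flag k"
  by (simp add: flag_def e_def axis_def h_eq_iff)

lemma e_in_cunit_sphere: "e k \<in> cunit_sphere"
  by (simp add: e_def axis_in_cunit_sphere)

lemma cscalar_e: "cscalar u (e k) = u $ h k"
  by (simp add: e_def cscalar_axis_right)

lemma subspace_flag: "vec.subspace (flag k)"
  by (auto simp: vec.subspace_def flag_def)

lemma flag_Suc: "{u \<in> flag k. cscalar u (e k) = 0} = flag (Suc k)"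
  by (auto simp: flag_def cscalar_e less_Suc_eq)

lemma dim_flag: "k \<le> CARD('n) \<Longrightarrow> vec.dim (flag k) = CARD('n) - k"
proof (induction k)
  case 0
  then show ?case by (simp add: flag_def card_cart_basis)
next
  case (Suc k)
  then have "vec.dim (flag k) = Suc (vec.dim {u \<in> flag k. cscalar u (e k) = 0})"
    using e_in_cunit_sphere[of k]
    by (intro dim_complement subspace_flag e_in_flag) (auto simp: cunit_sphere_def)
  with Suc show ?case by (simp add: flag_Suc)
qed

lemma f_ge:
  assumes "k < CARD('n)" "u \<in> flag k" "u \<in> cunit_sphere"
  shows "w k \<le> f u"
proof -
  have "w k \<le> w k * (\<Sum>i\<in>UNIV. cmod (u $ i))"
    using w_pos[of k] cunit_sphere_l1_ge[OF assms(3)] by simp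
  also have "\<dots> \<le> f u" using assms by (intro f_ge_l1)
  finally show ?thesis .
qed

lemma f_e:
  assumes k: "k < CARD('n)"
  shows "f (e k) = w k"
proof (rule antisym)
  have "cost (e k) 0 = (\<Sum>j<CARD('n). if j = k then w j else 0)"
    unfolding cost_def using k
    by (auto intro!: sum.cong simp: e_def axis_def h_eq_iff if_distrib[of cmod]
        if_distrib[of "(*) (w _)"] cong: if_cong)
  also have "\<dots> = w k" using k by simp
  finally show "f (e k) \<le> w k" using f_le_cost[of "e k" 0] by simp
  show "w k \<le> f (e k)"
    using k by (intro f_ge e_in_flag e_in_cunit_sphere)
qed

text \<open>Equality forces l1 norm 1, hence a unimodular multiple of some \<open>e j\<close>.
  Strict monotonicity of \<open>w\<close> gives \<open>j \<le> k\<close>, and membership in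
  \<open>flag k\<close> excludes \<open>j < k\<close>.\<close>

lemma f_eqD:
  assumes k: "k < CARD('n)" and u: "u \<in> flag k" "u \<in> cunit_sphere" and le: "f u \<le> w k"
  obtains \<alpha> where "cmod \<alpha> = 1" "u = \<alpha> *s e k"
proof -
  have "w k * (\<Sum>i\<in>UNIV. cmod (u $ i)) \<le> w k"
    using f_ge_l1[OF k u(1)] le by simp
  then have "(\<Sum>i\<in>UNIV. cmod (u $ i)) = 1"
    using w_pos[of k] cunit_sphere_l1_ge[OF u(2)] by simp
  then obtain i where i: "u = u $ i *s axis i 1" "cmod (u $ i) = 1"
    using cunit_sphere_l1_eq[OF u(2)] by blast
  obtain j where j: "j < CARD('n)" "i = h j" using ex_h by blast
  have "f u = w j"
    using i(2) j f_e[of j] f_scale[of "u $ i" "e j"] i(1) by (simp add: e_def)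
  then have "j \<le> k" using le w by (simp add: strict_mono_less_eq)
  moreover have "\<not> j < k" using u(1) i(2) j by (auto simp: flag_def)
  ultimately have "u = u $ i *s e k" using i(1) j by (simp add: e_def)
  with i(2) show thesis by (rule that)
qed

lemma is_arg_min_e:
  assumes "k < CARD('n)"
  shows "is_arg_min f (\<lambda>u. u \<in> flag k \<inter> cunit_sphere) (e k)"
  using assms f_ge
  by (fastforce simp: is_arg_min_def f_e e_in_flag e_in_cunit_sphere not_less)

section \<open>Existence and uniqueness of the minimal basis\<close>

lemma minimal_basis_flag:
  assumes "k < CARD('n)"
  shows "minimal_basis f (flag k) (map e [k..<CARD('n)])"
  using assms
proof (induction k rule: measure_induct_rule[where f = "\<lambda>k. CARD('n) - k"])
  case (less k)
  have e: "e k \<in> flag k \<inter> cunit_sphere"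
    using less.prems by (simp add: e_in_flag e_in_cunit_sphere)
  show ?case
  proof (cases "Suc k < CARD('n)")
    case True
    have "minimal_basis f {u \<in> flag k. cscalar u (e k) = 0} (map e [Suc k..<CARD('n)])"
      unfolding flag_Suc using True by (intro less.IH) auto
    moreover have "vec.dim (flag k) > 1"
      using True by (simp add: dim_flag)
    ultimately have "minimal_basis f (flag k) (e k # map e [Suc k..<CARD('n)])"
      using less.prems by (intro minimal_basis.step subspace_flag is_arg_min_e)
    then show ?thesis using less.prems by (simp add: upt_conv_Cons)
  next
    case False
    then have "CARD('n) = Suc k" using less.prems by simp
    then show ?thesis
      using e by (auto intro!: minimal_basis.single subspace_flag simp: dim_flag)
  qed
qed

lemma minimal_basis_flag_unique:
  assumes "minimal_basis f (flag k) bs" "k < CARD('n)"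
  shows "equivalent_bases bs (map e [k..<CARD('n)])"
  using assms
proof (induction bs arbitrary: k rule: list.induct)
  case Nil
  then show ?case by (auto elim: minimal_basis.cases)
next
  case (Cons b bs)
  \<comment> \<open>\<open>equivalent_bases\<close> asks for \<open>e k\<close> as a multiple of
    \<open>b\<close>, so the scalar is inverted.\<close>
  have unit: "\<exists>\<beta>. cmod \<beta> = 1 \<and> e k = \<beta> *s b" if "b = \<alpha> *s e k" "cmod \<alpha> = 1" for \<alpha>
  proof -
    have "\<alpha> \<noteq> 0" using that(2) by auto
    with that show ?thesis
      by (intro exI[of _ "inverse \<alpha>"]) (simp add: norm_inverse vector_smult_assoc)
  qed
  have upt: "[k..<CARD('n)] = k # [Suc k..<CARD('n)]"
    using Cons.prems by (simp add: upt_conv_Cons)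
  from Cons.prems(1) show ?case
  proof cases
    case single
    have b: "b \<in> flag k" "b \<in> cunit_sphere" using single by auto
    have n: "CARD('n) = Suc k"
      using single Cons.prems(2) by (simp add: dim_flag)
    \<comment> \<open>The base case of \<open>minimal_basis\<close> carries no minimality condition;
      here \<open>flag k\<close> is a line, and membership alone determines \<open>b\<close> up to a
      scalar.\<close>
    have "b = b $ h k *s e k"
      unfolding vec_eq_iff
    proof
      fix i
      obtain j where "j < CARD('n)" "i = h j" using ex_h by blast
      with b n show "b $ i = (b $ h k *s e k) $ i"
        by (auto simp: flag_def e_def axis_def less_Suc_eq)
    qed
    moreover from this have "cmod (b $ h k) = 1"
    proof -
      have "(\<Sum>i\<in>UNIV. (cmod (b $ i))\<^sup>2) = (cmod (b $ h k))\<^sup>2"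
        using b by (simp add: sum_h n flag_def)
      with b show ?thesis by (simp add: cunit_sphere_iff power2_eq_1_iff)
          (metis norm_ge_zero not_one_le_zero neg_0_le_iff_le)
    qed
    ultimately have "\<exists>\<beta>. cmod \<beta> = 1 \<and> e k = \<beta> *s b" by (rule unit)
    with single n show ?thesis by (simp add: equivalent_bases_def)
  next
    case step
    have b: "b \<in> flag k" "b \<in> cunit_sphere" using step by (auto simp: is_arg_min_def)
    have "f b \<le> w k"
      using step is_arg_min_e[OF Cons.prems(2)] f_e[OF Cons.prems(2)]
      by (auto simp: is_arg_min_def not_less)
    then obtain \<alpha> where \<alpha>: "cmod \<alpha> = 1" "b = \<alpha> *s e k"
      using f_eqD[OF Cons.prems(2) b] by blast
    have "Suc k < CARD('n)"
      using step Cons.prems(2) by (simp add: dim_flag)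
    moreover have "\<alpha> \<noteq> 0" using \<alpha>(1) by auto
    \<comment> \<open>The complement depends only on the line through \<open>b\<close>, so the
      choice of phase does not affect the recursion.\<close>
    then have "{u \<in> flag k. cscalar u b = 0} = flag (Suc k)"
      using flag_Suc[of k] by (simp add: \<alpha>(2) cscalar_scale_right)
    ultimately have "equivalent_bases bs (map e [Suc k..<CARD('n)])"
      using step by (intro Cons.IH) auto
    then show ?thesis
      using unit[OF \<alpha>(2,1)] by (auto simp: equivalent_bases_def upt nth_Cons split: nat.split)
  qed
qed

section \<open>The vector \<open>v\<close> and the sum in the inequality\<close>

lemma f_v_le: "f v \<le> s"
  using f_le_cost[of v 1] by (simp add: cost_def v_h)

lemma v_nonzero: "v \<noteq> 0"
  using a_pos by (metis (no_types) of_real_eq_0_iff less_irrefl v_h zero_index zero_less_card_finite)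

lemma v_real: "v \<in> real_vectors"
  by (simp add: v_def real_vectors_def)

lemma e_real: "e k \<in> real_vectors"
  by (simp add: e_def real_vectors_def axis_def)

lemma minimal_basis_UNIV: "minimal_basis f UNIV (map e [0..<CARD('n)])"
  using minimal_basis_flag[of 0] by (simp add: flag_def)

lemma minimal_basis_UNIV_unique:
  "minimal_basis f UNIV bs \<Longrightarrow> equivalent_bases bs (map e [0..<CARD('n)])"
  using minimal_basis_flag_unique[of 0] by (simp add: flag_def)

lemma sum_v_e: "(\<Sum>i<CARD('n). cmod (cscalar v (e i)) * f (e i)) = (\<Sum>i<CARD('n). w i * a i)"
  using a_pos by (intro sum.cong) (auto simp: f_e cscalar_e v_h less_imp_le)

end

section \<open>Choice of parameters and conclusion\<close>

lemma geometric_tail_bound: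
  fixes \<delta> \<eta> :: real
  assumes \<delta>: "0 < \<delta>" "\<delta> \<le> 1" "real n * 2 ^ n * \<delta> \<le> \<eta>" and k: "k < n"
  shows "(2 / \<delta>) ^ k * (\<Sum>j=k..<n. \<delta> ^ j) \<le> 1 + \<eta> + (\<Sum>j<k. (2 / \<delta>) ^ j * \<delta> ^ j)"
proof -
  have "(\<Sum>j=Suc k..<n. \<delta> ^ j) \<le> (\<Sum>j=Suc k..<n. \<delta> ^ Suc k)"
    using \<delta> by (intro sum_mono power_decreasing) auto
  also have "\<dots> \<le> real n * \<delta> ^ Suc k"
    using \<delta> by (simp add: mult_right_mono)
  finally have "(\<Sum>j=k..<n. \<delta> ^ j) \<le> \<delta> ^ k + real n * \<delta> ^ Suc k"
    using k by (simp add: sum.atLeast_Suc_lessThan)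
  then have "(2 / \<delta>) ^ k * (\<Sum>j=k..<n. \<delta> ^ j) \<le> (2 / \<delta>) ^ k * (\<delta> ^ k + real n * \<delta> ^ Suc k)"
    using \<delta> by (intro mult_left_mono) auto
  also have "\<dots> = 2 ^ k + real n * 2 ^ k * \<delta>"
    using \<delta> by (simp add: field_simps)
  also have "\<dots> \<le> 2 ^ k + real n * 2 ^ n * \<delta>"
    using \<delta> k by (intro add_left_mono mult_right_mono mult_left_mono power_increasing) auto
  also have "\<dots> \<le> 2 ^ k + \<eta>" using \<delta> by simp
  \<comment> \<open>Each product of weight and coordinate is \<open>2 ^ j\<close>, and a power of
    two exceeds the sum of all smaller ones by exactly 1, the main part of \<open>s\<close>.\<close>
  also have "(2 :: real) ^ k = 1 + (\<Sum>j<k. 2 ^ j)"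
    by (simp add: sum_power2 geometric_sum)
  also have "(\<Sum>j<k. 2 ^ j) = (\<Sum>j<k. (2 / \<delta>) ^ j * \<delta> ^ j)"
    using \<delta> by (simp flip: power_mult_distrib)
  finally show ?thesis by simp
qed

theorem proposition6:
  fixes \<epsilon> :: real
  assumes "\<epsilon> > 0"
  shows "\<exists>(f :: complex ^ 'n \<Rightarrow> real) v es.
    is_cnorm f \<and> v \<noteq> 0 \<and> v \<in> real_vectors \<and>
    minimal_basis f UNIV es \<and> set es \<subseteq> real_vectors \<and>
    (\<forall>bs. minimal_basis f UNIV bs \<longrightarrow> equivalent_bases bs es) \<and>
    (2 ^ CARD('n) - 1 - \<epsilon>) * f v
      \<le> (\<Sum>i<CARD('n). cmod (cscalar v (es ! i)) * f (es ! i))"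
proof -
  let ?n = "CARD('n)"
  \<comment> \<open>Chosen so that \<open>2 ^ ?n * \<eta> = \<epsilon>\<close>. The bound on
    \<delta> then makes the error from the lower-order terms of the tail at most \<eta>.\<close>
  define \<eta> where "\<eta> = \<epsilon> / 2 ^ ?n"
  define \<delta> where "\<delta> = min 1 (\<eta> / (real ?n * 2 ^ ?n))"
  have \<eta>: "\<eta> > 0" using assms by (simp add: \<eta>_def)
  then have \<delta>: "0 < \<delta>" "\<delta> \<le> 1" by (auto simp: \<delta>_def)
  have "\<delta> \<le> \<eta> / (real ?n * 2 ^ ?n)" by (simp add: \<delta>_def)
  then have \<delta>\<eta>: "real ?n * 2 ^ ?n * \<delta> \<le> \<eta>" by (simp add: field_simps)
  obtain h :: "nat \<Rightarrow> 'n" where h: "bij_betw h {..<?n} UNIV"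
    using ex_bij_betw_nat_finite[of "UNIV :: 'n set"] by (auto simp: lessThan_atLeast0)
  interpret flag_norm h "\<lambda>j. (2 / \<delta>) ^ j" "\<lambda>j. \<delta> ^ j" "1 + \<eta>"
  proof
    show "strict_mono (\<lambda>j. (2 / \<delta>) ^ j)"
      using \<delta> by (auto intro!: strict_monoI power_strict_increasing)
  qed (use h \<delta> \<delta>\<eta> geometric_tail_bound in auto)
  have sum: "(\<Sum>i<?n. (2 / \<delta>) ^ i * \<delta> ^ i) = 2 ^ ?n - 1"
    using \<delta> by (simp add: geometric_sum flip: power_mult_distrib)
  have ge_1: "(1::real) \<le> 2 ^ ?n" by simp
  have "(2 ^ ?n - 1 - \<epsilon>) * f v \<le> 2 ^ ?n - 1"
  \<comment> \<open>The upper bound on \<open>f v\<close> can be multiplied only by a nonnegative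
    factor, so large \<epsilon> is treated apart.\<close>
  proof (cases "2 ^ ?n - 1 - \<epsilon> \<le> 0")
    case True
    have "0 \<le> f v" using is_cnorm_f by (simp add: is_cnorm_def)
    with True have "(2 ^ ?n - 1 - \<epsilon>) * f v \<le> 0" by (simp add: mult_nonpos_nonneg)
    with ge_1 show ?thesis by linarith
  next
    case False
    then have "(2 ^ ?n - 1 - \<epsilon>) * f v \<le> (2 ^ ?n - 1 - \<epsilon>) * (1 + \<eta>)"
      using f_v_le by (intro mult_left_mono) auto
    also have "\<dots> \<le> (2 ^ ?n - 1 - \<epsilon>) + 2 ^ ?n * \<eta>"
      using \<eta> assms by (simp add: algebra_simps)
    also have "\<dots> = 2 ^ ?n - 1" by (simp add: \<eta>_def)
    finally show ?thesis .
  qed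
  then have "(2 ^ ?n - 1 - \<epsilon>) * f v \<le>
      (\<Sum>i<?n. cmod (cscalar v (map e [0..<?n] ! i)) * f (map e [0..<?n] ! i))"
    using sum_v_e sum by simp
  then show ?thesis
    using is_cnorm_f v_nonzero v_real minimal_basis_UNIV minimal_basis_UNIV_unique e_real
    by (intro exI[of _ f] exI[of _ v] exI[of _ "map e [0..<?n]"]) auto
qed

end
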